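(* Let $t>0$ and $\rho\in tR(\mathbb{R}^3)$. For every $\epsilon>0$ there exists $\sigma\in tR(\mathbb{R}^3)\cap L^\infty(\mathbb{R}^3)$ such that $W^\infty(\rho,\sigma)<\epsilon$. Moreover, if $\operatorname{spt}\rho$ is bounded, then $\operatorname{spt}\sigma$ is also bounded (i.e. $\sigma$ can be chosen with bounded support).
   Context: $tR(\mathbb{R}^3)=\{\rho\in L^{4/3}(\mathbb{R}^3):\rho\ge0,\ \int_{\mathbb{R}^3}\rho\,dx=t\}$. Each $\rho$ in it is identified with the measure $\rho\,dx$; $\operatorname{spt}\rho$ is the smallest closed set carrying the full mass of $\rho$. For $t=1$, the Wasserstein $L^\infty$ distance is $W^\infty(\rho,\kappa)=\inf\|f-g\|_{L^\infty([0,1])}$, the infimum over Borel maps $f,g:[0,1]\to\mathbb{R}^3$ that push Lebesgue measure on $[0,1]$ forward to $\rho$ and $\kappa$ respectively (it may be $+\infty$). For general $t>0$ use the same definition with Lebesgue measure on $[0,1]$ multiplied by $t$; equivalently $W^\infty(t\rho,t\kappa)=W^\infty(\rho,\kappa)$ for $\rho,\kappa\in R(\mathbb{R}^3)=1\cdot R(\mathbb{R}^3)$. *)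

theory Defs
  imports "HOL-Analysis.Analysis" "HOL-Probability.Essential_Supremum"
begin

(* Elements of L^p spaces are rendered by Borel representatives; properties of the
   a.e. equivalence class, such as nonnegativity, are therefore stated a.e. *)

definition Lp_space :: "real \<Rightarrow> 'a measure \<Rightarrow> ('a \<Rightarrow> real) set" where
  "Lp_space p M = {f \<in> borel_measurable M. integrable M (\<lambda>x. \<bar>f x\<bar> powr p)}"

definition Linf_norm :: "'a measure \<Rightarrow> ('a \<Rightarrow> 'b::real_normed_vector) \<Rightarrow> ennreal" where
  "Linf_norm M f = esssup M (\<lambda>x. ennreal (norm (f x)))"

definition Linf_space :: "'a measure \<Rightarrow> ('a \<Rightarrow> real) set" where
  "Linf_space M = {f \<in> borel_measurable M. Linf_norm M f < \<infinity>}"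

definition mass_densities :: "real \<Rightarrow> (real^3 \<Rightarrow> real) set" where
  "mass_densities t = {\<rho> \<in> Lp_space (4/3) lborel.
      (AE x in lborel. 0 \<le> \<rho> x) \<and> has_bochner_integral lborel \<rho> t}"

definition density_measure :: "(real^3 \<Rightarrow> real) \<Rightarrow> (real^3) measure" where
  "density_measure \<rho> = density lborel (\<lambda>x. ennreal (\<rho> x))"

definition measure_support :: "'a::topological_space measure \<Rightarrow> 'a set" where
  "measure_support \<mu> = \<Inter>{C. closed C \<and> emeasure \<mu> (- C) = 0}"

(* The intersection in measure_support is itself one of the closed sets of full mass,
   hence the smallest one. *)
lemma closed_measure_support: "closed (measure_support \<mu>)"
  unfolding measure_support_def by (rule closed_Inter) auto

lemma emeasure_compl_measure_support:
  fixes \<mu> :: "'a::second_countable_topology measure"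
  assumes "sets \<mu> = sets borel"
  shows "emeasure \<mu> (- measure_support \<mu>) = 0"
proof -
  let ?F = "{U. open U \<and> emeasure \<mu> U = 0}"
  have eq: "- measure_support \<mu> = \<Union>?F"
  proof
    show "- measure_support \<mu> \<subseteq> \<Union>?F"
      unfolding measure_support_def by (auto simp: closed_def)
    show "\<Union>?F \<subseteq> - measure_support \<mu>"
      unfolding measure_support_def by clarsimp (metis closed_Compl double_compl ComplD)
  qed
  obtain F where F: "F \<subseteq> ?F" "countable F" "\<Union>F = \<Union>?F"
    by (rule Lindelof[of ?F]) auto
  have "(\<Union>U\<in>F. U) \<in> null_sets \<mu>"
    using F(1) assms by (intro null_sets_UN' F(2)) (auto simp: null_sets_def)
  then show ?thesis
    using F(3) eq by (auto simp: null_sets_def)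
qed

definition unit_interval_measure :: "real measure" where
  "unit_interval_measure = restrict_space lborel {0..1}"

(* W^infinity for measures of total mass t.  The infimum over the empty set is infinity. *)
definition Winf :: "real \<Rightarrow> (real^3 \<Rightarrow> real) \<Rightarrow> (real^3 \<Rightarrow> real) \<Rightarrow> ennreal" where
  "Winf t \<rho> \<kappa> = Inf {Linf_norm unit_interval_measure (\<lambda>s. f s - g s) | f g.
      f \<in> borel_measurable unit_interval_measure \<and>
      g \<in> borel_measurable unit_interval_measure \<and>
      distr (scale_measure (ennreal t) unit_interval_measure) borel f = density_measure \<rho> \<and>
      distr (scale_measure (ennreal t) unit_interval_measure) borel g = density_measure \<kappa>}"

end

theory Submission
  imports Defs "HOL-Probability.Weak_Convergence"
begin

text \<open>
  Take for \<open>\<sigma>\<close> the convolution of \<open>\<rho>\<close> with the uniform probability density on a ball of radius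
  \<open>\<delta> < \<epsilon>\<close>; it is bounded because \<open>\<rho>\<close> is integrable. Moving each point \<open>x\<close> to a uniformly chosen
  point of the ball around it couples \<open>\<rho>\<close> with \<open>\<sigma>\<close> and moves no mass farther than \<open>\<delta>\<close>. A coupling
  is the image of Lebesgue measure on the unit interval under a single Borel map, whose two
  components are the required maps: embed the product space into the line by a
  Borel map with a Borel left inverse, and apply the left inverse to the quantile function of the
  image of the coupling.
\<close>

section \<open>Coding bit sequences as real numbers\<close>

definition base4 :: "(nat \<Rightarrow> bool) \<Rightarrow> real" where
  "base4 b = (\<Sum>n. of_bool (b n) / 4 ^ Suc n)"

lemma sums_quarter_powers: "(\<lambda>n. 1 / 4 ^ Suc n :: real) sums (1 / 3)"
proof -
  have "(\<lambda>n. (1/4) * (1/4) ^ n :: real) sums ((1/4) * (1 / (1 - 1/4)))"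
    by (intro sums_mult geometric_sums) simp
  then show ?thesis by (simp add: power_one_over)
qed

lemma summable_base4: "summable (\<lambda>n. of_bool (b n) / 4 ^ Suc n :: real)"
  by (rule summable_comparison_test'[OF sums_summable[OF sums_quarter_powers], of 0]) simp

lemma base4_nonneg: "0 \<le> base4 b"
  unfolding base4_def by (intro suminf_nonneg summable_base4) simp

text \<open>Comparison with the sequence of all ones gives at most 1/3. The strict bound lets the
  floor function separate a leading digit from its tail; in base 2 the all-ones tail would reach
  1.\<close>

lemma base4_less_1: "base4 b < 1"
proof -
  have "base4 b \<le> (\<Sum>n. 1 / 4 ^ Suc n)"
    unfolding base4_def
    by (intro suminf_le summable_base4 sums_summable[OF sums_quarter_powers]) simp
  also have "\<dots> = 1 / 3"
    using sums_quarter_powers by (rule sums_unique[symmetric])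
  finally show ?thesis by simp
qed

lemma base4_shift: "4 * base4 b = of_bool (b 0) + base4 (\<lambda>n. b (Suc n))"
proof -
  have "base4 b = of_bool (b 0) / 4 + (\<Sum>n. of_bool (b (Suc n)) / 4 ^ Suc (Suc n))"
    unfolding base4_def using suminf_split_head[OF summable_base4[of b]] by simp
  also have "(\<Sum>n. of_bool (b (Suc n)) / 4 ^ Suc (Suc n) :: real) = base4 (\<lambda>n. b (Suc n)) / 4"
    unfolding base4_def using suminf_divide[OF summable_base4[of "\<lambda>n. b (Suc n)"], of 4]
    by (simp add: mult_ac)
  finally show ?thesis by simp
qed

text \<open>Digits can be read back by floor and parity. Multiplication by 4 moves the first digit
  in front of the point, and the tail stays in \<open>[0,1)\<close>, so the floor is that digit;
  later digits follow by induction on the shifted sequence.\<close>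

lemma odd_floor_base4: "odd \<lfloor>4 ^ Suc n * base4 b\<rfloor> \<longleftrightarrow> b n"
proof (induction n arbitrary: b)
  case 0
  have "\<lfloor>4 * base4 b\<rfloor> = of_bool (b 0)"
    unfolding base4_shift using base4_nonneg base4_less_1 by (auto simp: floor_eq_iff)
  then show ?case by simp
next
  case (Suc n)
  have "4 ^ Suc (Suc n) * base4 b = 4 ^ Suc n * (4 * base4 b)"
    by simp
  \<comment> \<open>The leading digit now contributes an integer multiple of 4, which the floor
    passes through and which leaves the parity unchanged.\<close>
  also have "\<dots> = 4 ^ Suc n * base4 (\<lambda>n. b (Suc n)) + of_int (4 ^ Suc n * of_bool (b 0))"
    unfolding base4_shift by (simp add: algebra_simps)
  finally have "\<lfloor>4 ^ Suc (Suc n) * base4 b\<rfloor> =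
      \<lfloor>4 ^ Suc n * base4 (\<lambda>n. b (Suc n))\<rfloor> + 4 ^ Suc n * of_bool (b 0)"
    by (metis floor_add_int)
  then show ?case using Suc.IH[of "\<lambda>n. b (Suc n)"] by simp
qed

section \<open>Borel embedding of Euclidean space into the line\<close>

lemma SUP_rat_below:
  "(SUP q::rat. if real_of_rat q < x then ereal (real_of_rat q) else -\<infinity>) = ereal x"
    (is "(SUP q. ?f q) = _")
proof (rule antisym)
  show "(SUP q. ?f q) \<le> ereal x"
    by (rule SUP_least) auto
  show "ereal x \<le> (SUP q. ?f q)"
  proof (rule ccontr)
    assume "\<not> ?thesis"
    then have "(SUP q. ?f q) < ereal x"
      by simp
    then obtain y where y: "(SUP q. ?f q) < ereal y" "y < x"
      using ereal_dense2 by force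
    obtain q where q: "y < real_of_rat q" "real_of_rat q < x"
      using of_rat_dense[OF y(2)] by auto
    have "ereal (real_of_rat q) \<le> (SUP q. ?f q)"
      by (rule SUP_upper2[of q]) (use q in auto)
    with y q show False by (meson ereal_less_eq(3) leD less_imp_le order_le_less_trans)
  qed
qed

text \<open>
  The base 4 digits of \<open>e x\<close> record which inequalities \<open>q < x \<bullet> i\<close> with rational \<open>q\<close> hold.
  Base 4 with digits 0 and 1 only, rather than base 2, makes the expansion unambiguous.
\<close>
lemma borel_embedding_real:
  obtains e :: "'a::euclidean_space \<Rightarrow> real" and d :: "real \<Rightarrow> 'a"
  where "e \<in> borel_measurable borel" "d \<in> borel_measurable borel" "\<And>x. d (e x) = x"
proof -
  define S where "S = (Basis :: 'a set) \<times> (UNIV :: rat set)"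
  have S: "countable S" "S \<noteq> {}"
    unfolding S_def by (auto intro!: countable_SIGMA intro: countable_finite)
  define b where "b x n = (real_of_rat (snd (from_nat_into S n)) < x \<bullet> fst (from_nat_into S n))"
    for x :: 'a and n
  define e where "e x = base4 (b x)" for x
  \<comment> \<open>Each coordinate is recovered as the supremum of the rationals below it;
    \<open>-\<infinity>\<close> is neutral for the rationals not selected. For \<open>r\<close>
    outside the range of \<open>e\<close> the supremum may be infinite, so it is taken in
    \<open>ereal\<close>, and \<open>real_of_ereal\<close> then yields 0.\<close>
  define d :: "real \<Rightarrow> 'a" where "d r = (\<Sum>i\<in>Basis. real_of_ereal (SUP q::rat.
      if odd \<lfloor>4 ^ Suc (to_nat_on S (i, q)) * r\<rfloor> then ereal (real_of_rat q) else -\<infinity>) *\<^sub>R i)" for r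
  have [measurable]: "Measurable.pred borel (\<lambda>x. b x n)" for n
    unfolding b_def by measurable
  have "e \<in> borel_measurable borel"
    unfolding e_def base4_def by measurable
  moreover have "d \<in> borel_measurable borel"
    unfolding d_def by measurable
  moreover have "d (e x) = x" for x
  proof -
    have "odd \<lfloor>4 ^ Suc (to_nat_on S (i, q)) * e x\<rfloor> \<longleftrightarrow> real_of_rat q < x \<bullet> i"
      if "i \<in> Basis" for i q
      unfolding e_def odd_floor_base4 b_def
      using that S by (simp add: from_nat_into_to_nat_on S_def)
    then have "d (e x) = (\<Sum>i\<in>Basis. (x \<bullet> i) *\<^sub>R i)"
      unfolding d_def by (simp only: SUP_rat_below real_of_ereal.simps cong: sum.cong)
    then show ?thesis by (simp add: euclidean_representation)
  qed
  ultimately show ?thesis using that by blast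
qed

section \<open>Finite measures as images of the unit interval\<close>

lemma prob_space_eq_distr_unit_interval:
  fixes M :: "'a::euclidean_space measure"
  assumes "prob_space M" and M[measurable_cong]: "sets M = sets borel"
  obtains h where "h \<in> borel_measurable unit_interval_measure"
    "distr unit_interval_measure borel h = M"
proof -
  obtain e :: "'a \<Rightarrow> real" and d :: "real \<Rightarrow> 'a"
    where [measurable]: "e \<in> borel_measurable borel" "d \<in> borel_measurable borel"
      and de: "\<And>x. d (e x) = x"
    using borel_embedding_real by metis
  interpret prob_space M by fact
  \<comment> \<open>The image of \<open>M\<close> under \<open>e\<close> lives on the line, so it
    has a quantile function, here \<open>R.I\<close>.\<close>
  have "real_distribution (distr M borel e)"
    by (rule real_distribution_distr) simp
  then interpret R: cdf_distribution "distr M borel e"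
    by (simp add: cdf_distribution_def)
  let ?\<Omega> = "restrict_space lborel {0<..<1::real}"
  have I[measurable]: "R.I \<in> borel_measurable ?\<Omega>"
    using R.measurable_CI by (simp cong: measurable_cong_sets add: sets_restrict_space)
  \<comment> \<open>At the endpoints the infimum defining the quantile function may be over an empty
    or unbounded set. They form a null set, so the value 0 there does not affect the image measure
    and keeps \<open>h\<close> Borel on the whole line.\<close>
  define h where "h s = (if s \<in> {0<..<1} then d (R.I s) else 0)" for s
  have h_borel[measurable]: "h \<in> borel_measurable borel"
  proof -
    have "(\<lambda>s. d (R.I s)) \<in> borel_measurable (restrict_space borel {0<..<1})"
      by (rule measurable_compose[OF R.measurable_CI]) simp
    then show ?thesis
      unfolding h_def
      by (subst measurable_If_restrict_space_iff) (simp_all del: greaterThanLessThan_iff)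
  qed
  have h[measurable]: "h \<in> borel_measurable unit_interval_measure"
    unfolding unit_interval_measure_def by (rule measurable_restrict_space1) simp
  have "distr unit_interval_measure borel h = distr ?\<Omega> borel (\<lambda>s. d (R.I s))"
  proof (rule measure_eqI)
    fix A assume "A \<in> sets (distr unit_interval_measure borel h)"
    then have A[measurable]: "A \<in> sets borel" by simp
    have "emeasure (distr unit_interval_measure borel h) A = emeasure lborel (h -` A \<inter> {0..1})"
      by (subst emeasure_distr[OF h A])
        (simp add: unit_interval_measure_def space_restrict_space emeasure_restrict_space)
    also have "\<dots> = emeasure lborel (h -` A \<inter> {0<..<1})"
    proof (rule emeasure_eq_AE)
      show "AE s in lborel. s \<in> h -` A \<inter> {0..1} \<longleftrightarrow> s \<in> h -` A \<inter> {0<..<1}"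
        using AE_lborel_singleton[of 0] AE_lborel_singleton[of 1] by eventually_elim auto
      show "h -` A \<inter> {0..1} \<in> sets lborel" "h -` A \<inter> {0<..<1} \<in> sets lborel"
        using measurable_sets[OF h_borel A] by auto
    qed
    also have "\<dots> = emeasure lborel ((\<lambda>s. d (R.I s)) -` A \<inter> {0<..<1})"
      by (rule arg_cong[where f="emeasure lborel"]) (auto simp: h_def)
    also have "\<dots> = emeasure (distr ?\<Omega> borel (\<lambda>s. d (R.I s))) A"
      by (subst emeasure_distr) (auto simp: space_restrict_space emeasure_restrict_space)
    finally show "emeasure (distr unit_interval_measure borel h) A = \<dots>" .
  qed simp
  also have "\<dots> = distr (distr ?\<Omega> borel R.I) borel d"
    by (subst distr_distr) (auto simp: comp_def)
  \<comment> \<open>The quantile function carries the uniform measure on \<open>(0,1)\<close> to the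
    image of \<open>M\<close> under \<open>e\<close>; the left inverse \<open>d\<close> then brings
    it back to \<open>M\<close>.\<close>
  also have "\<dots> = distr M borel (\<lambda>x. d (e x))"
    unfolding R.distr_I_eq_M by (subst distr_distr) (auto simp: comp_def)
  also have "\<dots> = M"
    unfolding de using M by (simp add: distr_id2)
  finally show ?thesis using h that by blast
qed

lemma distr_scale_measure:
  assumes "f \<in> measurable M N"
  shows "distr (scale_measure r M) N f = scale_measure r (distr M N f)"
  by (rule measure_eqI) (use assms in \<open>auto simp: emeasure_distr space_scale_measure
      measurable_def\<close>)

text \<open>Dividing by the total mass reduces this to probability measures, and taking images
  commutes with scaling.\<close>

lemma finite_measure_eq_distr_unit_interval:
  fixes M :: "'a::euclidean_space measure"
  assumes "t > 0" and tot: "emeasure M (space M) = ennreal t" and M: "sets M = sets borel"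
  obtains h where "h \<in> borel_measurable unit_interval_measure"
    "distr (scale_measure (ennreal t) unit_interval_measure) borel h = M"
proof -
  have "prob_space (scale_measure (ennreal (1 / t)) M)"
    using assms by (intro prob_spaceI) (simp add: space_scale_measure flip: ennreal_mult)
  then obtain h where h: "h \<in> borel_measurable unit_interval_measure"
    and d: "distr unit_interval_measure borel h = scale_measure (ennreal (1 / t)) M"
    using M by (elim prob_space_eq_distr_unit_interval) auto
  have "distr (scale_measure (ennreal t) unit_interval_measure) borel h = M"
    using \<open>t > 0\<close> by (simp add: distr_scale_measure h d flip: ennreal_mult)
  with h that show ?thesis by blast
qed

section \<open>Couplings as upper bounds for \<open>Winf\<close>\<close>

lemma Winf_le_coupling:
  fixes \<gamma> :: "((real^3) \<times> (real^3)) measure"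
  assumes "t > 0" and "emeasure \<gamma> (space \<gamma>) = ennreal t" and \<gamma>: "sets \<gamma> = sets borel"
    and fst: "distr \<gamma> borel fst = density_measure \<rho>"
    and snd: "distr \<gamma> borel snd = density_measure \<sigma>"
    and AE: "AE z in \<gamma>. dist (fst z) (snd z) \<le> c"
  shows "Winf t \<rho> \<sigma> \<le> ennreal c"
proof -
  let ?U = "scale_measure (ennreal t) unit_interval_measure"
  \<comment> \<open>One map into the product represents the coupling; its components have the two
    marginals as images and inherit the distance bound almost everywhere.\<close>
  obtain h where h[measurable]: "h \<in> borel_measurable unit_interval_measure"
    and d: "distr ?U borel h = \<gamma>"
    using finite_measure_eq_distr_unit_interval[OF assms(1-3)] .
  have hU[measurable]: "h \<in> borel_measurable ?U"
    using h by (simp cong: measurable_cong_sets)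
  have f[measurable]: "(\<lambda>s. fst (h s)) \<in> borel_measurable unit_interval_measure"
    and g[measurable]: "(\<lambda>s. snd (h s)) \<in> borel_measurable unit_interval_measure"
    using h by (auto simp: borel_prod[symmetric])
  have [measurable]: "(fst :: (real^3) \<times> (real^3) \<Rightarrow> _) \<in> borel_measurable borel"
    "(snd :: (real^3) \<times> (real^3) \<Rightarrow> _) \<in> borel_measurable borel"
    by (auto simp: borel_prod[symmetric])
  have "AE s in ?U. dist (fst (h s)) (snd (h s)) \<le> c"
    using AE unfolding d[symmetric] by (subst (asm) AE_distr_iff) auto
  \<comment> \<open>Scaling by the nonzero factor \<open>t\<close> preserves null sets.\<close>
  then have "AE s in unit_interval_measure. dist (fst (h s)) (snd (h s)) \<le> c"
    using \<open>t > 0\<close> by (simp add: AE_iff_measurable[OF _ refl] eventually_ae_filter null_sets_def space_scale_measure)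
  then have "Linf_norm unit_interval_measure (\<lambda>s. fst (h s) - snd (h s)) \<le> ennreal c"
    unfolding Linf_norm_def
    by (intro esssup_I) (auto simp: dist_norm ennreal_leI elim!: eventually_mono)
  moreover have "distr ?U borel (\<lambda>s. fst (h s)) = density_measure \<rho>"
    unfolding fst[symmetric] d[symmetric] by (subst distr_distr) (auto simp: comp_def)
  moreover have "distr ?U borel (\<lambda>s. snd (h s)) = density_measure \<sigma>"
    unfolding snd[symmetric] d[symmetric] by (subst distr_distr) (auto simp: comp_def)
  ultimately show ?thesis
    unfolding Winf_def using f g by (intro Inf_lower2[OF CollectI]) blast+
qed

section \<open>Supports and bounded densities\<close>

lemma measure_support_minimal:
  "closed C \<Longrightarrow> emeasure \<mu> (- C) = 0 \<Longrightarrow> measure_support \<mu> \<subseteq> C"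
  unfolding measure_support_def by auto

lemma AE_measure_support:
  fixes \<mu> :: "'a::second_countable_topology measure"
  assumes "sets \<mu> = sets borel"
  shows "AE x in \<mu>. x \<in> measure_support \<mu>"
  using emeasure_compl_measure_support[OF assms] closed_measure_support[of \<mu>]
  by (intro AE_I'[of "- measure_support \<mu>"]) (auto simp: null_sets_def assms)

text \<open>Interpolation between integrability and boundedness: \<open>\<sigma> powr (4/3)\<close>
  is \<open>\<sigma> powr (1/3)\<close> times \<open>\<sigma>\<close>, hence at most the constant
  \<open>B powr (1/3)\<close> times the integrable \<open>\<sigma>\<close>.\<close>

lemma bounded_mass_density:
  assumes [measurable]: "\<sigma> \<in> borel_measurable borel"
    and "\<And>x. 0 \<le> \<sigma> x" "\<And>x. \<sigma> x \<le> B" and "0 \<le> t"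
    and tot: "(\<integral>\<^sup>+x. ennreal (\<sigma> x) \<partial>lborel) = ennreal t"
  shows "\<sigma> \<in> mass_densities t \<inter> Linf_space lborel"
proof -
  have int: "has_bochner_integral lborel \<sigma> t"
    using assms by (intro has_bochner_integral_nn_integral) auto
  have "integrable lborel (\<lambda>x. \<bar>\<sigma> x\<bar> powr (4/3))"
  proof (rule Bochner_Integration.integrable_bound)
    show "integrable lborel (\<lambda>x. B powr (1/3) * \<sigma> x)"
      using int by (intro integrable_mult_right) (rule has_bochner_integral_iff[THEN iffD1, THEN conjunct1])
    have "\<bar>\<sigma> x\<bar> powr (4/3) \<le> B powr (1/3) * \<sigma> x" for x
    proof -
      have "\<bar>\<sigma> x\<bar> powr (4/3) = \<sigma> x powr (1/3) * \<sigma> x powr 1"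
        using assms(2)[of x] by (subst powr_add[symmetric]) simp
      also have "\<dots> \<le> B powr (1/3) * \<sigma> x"
        using assms(2,3)[of x] by (auto intro!: mult_right_mono powr_mono2)
      finally show ?thesis .
    qed
    then show "AE x in lborel. norm (\<bar>\<sigma> x\<bar> powr (4/3)) \<le> norm (B powr (1/3) * \<sigma> x)"
      using assms(2) by (intro AE_I2) (simp add: abs_mult)
  qed simp
  moreover have "Linf_norm lborel \<sigma> \<le> ennreal B"
    unfolding Linf_norm_def using assms(2,3) by (intro esssup_I) (auto intro!: AE_I2 ennreal_leI)
  ultimately show ?thesis
    using int assms(2) unfolding mass_densities_def Lp_space_def Linf_space_def
    by (auto intro: le_less_trans)
qed

section \<open>Averaging a density over small balls\<close>

theorem lemma4p5:
  fixes t :: real and \<rho> :: "real^3 \<Rightarrow> real"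
  assumes "t > 0" and "\<rho> \<in> mass_densities t"
  shows "\<forall>\<epsilon>::real. \<epsilon> > 0 \<longrightarrow>
    (\<exists>\<sigma>. \<sigma> \<in> mass_densities t \<inter> Linf_space lborel \<and>
         Winf t \<rho> \<sigma> < ennreal \<epsilon> \<and>
         (bounded (measure_support (density_measure \<rho>)) \<longrightarrow>
          bounded (measure_support (density_measure \<sigma>))))"
proof (intro allI impI)
  fix \<epsilon> :: real assume "\<epsilon> > 0"
  have [measurable]: "\<rho> \<in> borel_measurable borel"
    and \<rho>_nonneg: "AE x in lborel. 0 \<le> \<rho> x" and \<rho>_int: "has_bochner_integral lborel \<rho> t"
    using assms(2) by (auto simp: mass_densities_def Lp_space_def)
  have \<rho>_tot: "(\<integral>\<^sup>+x. ennreal (\<rho> x) \<partial>lborel) = ennreal t"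
    using \<rho>_int \<rho>_nonneg by (simp add: has_bochner_integral_iff nn_integral_eq_integral)
  \<comment> \<open>The coupling only yields a distance at most \<open>\<delta>\<close>, so a radius
    strictly below \<open>\<epsilon>\<close> is chosen.\<close>
  define \<delta> where "\<delta> = \<epsilon> / 2"
  have \<delta>: "0 < \<delta>" "\<delta> < \<epsilon>"
    using \<open>\<epsilon> > 0\<close> by (auto simp: \<delta>_def)
  \<comment> \<open>The volume of a ball of radius \<open>\<delta>\<close> in dimension 3, which
    normalizes the uniform density.\<close>
  define v where "v = unit_ball_vol 3 * \<delta> ^ 3"
  have v: "0 < v" "\<And>x :: real^3. emeasure lborel (ball x \<delta>) = ennreal v"
    using \<delta> by (auto simp: v_def emeasure_ball)
  \<comment> \<open>Joint density of the coupling: the mass at the first point is spread evenly over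
    the ball around it. Integrating out the first variable gives the convolution
    \<open>\<sigma>\<close>.\<close>
  define K :: "(real^3) \<times> (real^3) \<Rightarrow> ennreal" where
    "K z = ennreal (\<rho> (fst z)) * (indicator {z. dist (fst z) (snd z) < \<delta>} z * ennreal (1 / v))" for z
  define \<gamma> where "\<gamma> = density (lborel \<Otimes>\<^sub>M lborel) K"
  define \<sigma> where "\<sigma> y = enn2real (\<integral>\<^sup>+x. K (x, y) \<partial>lborel)" for y
  have K[measurable]: "K \<in> borel_measurable (lborel \<Otimes>\<^sub>M lborel)"
    unfolding K_def by measurable
  have K_fst: "(\<integral>\<^sup>+y. K (x, y) \<partial>lborel) = ennreal (\<rho> x)" for x
  proof -
    have "(\<integral>\<^sup>+y. K (x, y) \<partial>lborel) =
        (\<integral>\<^sup>+y. (ennreal (\<rho> x) * ennreal (1 / v)) * indicator (ball x \<delta>) y \<partial>lborel)"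
      by (intro nn_integral_cong) (auto simp: K_def indicator_def)
    also have "\<dots> = ennreal (\<rho> x) * (ennreal (1 / v) * ennreal v)"
      by (subst nn_integral_cmult_indicator) (auto simp: v mult.assoc)
    also have "ennreal (1 / v) * ennreal v = 1"
      using v(1) by (simp flip: ennreal_mult)
    finally show ?thesis by simp
  qed
  \<comment> \<open>Dropping the indicator bounds the kernel by \<open>1 / v\<close>. This gives
    both the finiteness that makes \<open>enn2real\<close> harmless in \<open>\<sigma>\<close> and
    the uniform bound on \<open>\<sigma>\<close>.\<close>
  have K_snd: "(\<integral>\<^sup>+x. K (x, y) \<partial>lborel) \<le> ennreal (t / v)" for y
  proof -
    have "(\<integral>\<^sup>+x. K (x, y) \<partial>lborel) \<le> (\<integral>\<^sup>+x. ennreal (\<rho> x) * ennreal (1 / v) \<partial>lborel)"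
      by (intro nn_integral_mono) (auto simp: K_def indicator_def)
    also have "\<dots> = ennreal t * ennreal (1 / v)"
      by (simp add: nn_integral_multc \<rho>_tot)
    also have "\<dots> = ennreal (t / v)"
      using v(1) \<open>t > 0\<close> by (simp flip: ennreal_mult)
    finally show ?thesis .
  qed
  have \<sigma>_K: "ennreal (\<sigma> y) = (\<integral>\<^sup>+x. K (x, y) \<partial>lborel)" for y
    unfolding \<sigma>_def by (rule ennreal_enn2real[OF le_less_trans[OF K_snd]]) simp
  have \<sigma>_bounds: "0 \<le> \<sigma> y" "\<sigma> y \<le> t / v" for y
    unfolding \<sigma>_def using K_snd[of y] v(1) \<open>t > 0\<close> by (auto intro!: enn2real_leI)
  have [measurable]: "\<sigma> \<in> borel_measurable borel"
    unfolding \<sigma>_def by measurable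
  have \<gamma>_borel: "sets \<gamma> = sets borel"
    unfolding \<gamma>_def by (simp add: lborel_prod)
  have fst[measurable]: "fst \<in> borel_measurable \<gamma>" and snd[measurable]: "snd \<in> borel_measurable \<gamma>"
    unfolding \<gamma>_def by measurable
  \<comment> \<open>By Tonelli, integrating \<open>K\<close> over the other variable gives the
    density of a marginal; the second marginal uses the opposite order of integration.\<close>
  have fst_\<gamma>: "distr \<gamma> borel fst = density_measure \<rho>"
  proof (rule measure_eqI)
    fix A assume "A \<in> sets (distr \<gamma> borel fst)"
    then have A[measurable]: "A \<in> sets borel" by simp
    have "emeasure (distr \<gamma> borel fst) A = (\<integral>\<^sup>+z. K z * indicator A (fst z) \<partial>(lborel \<Otimes>\<^sub>M lborel))"
      by (subst nn_integral_indicator[symmetric], simp, subst nn_integral_distr[OF fst], simp)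
        (simp add: \<gamma>_def nn_integral_density)
    also have "\<dots> = (\<integral>\<^sup>+x. (\<integral>\<^sup>+y. K (x, y) * indicator A x \<partial>lborel) \<partial>lborel)"
      by (subst lborel.nn_integral_fst[symmetric]) auto
    also have "\<dots> = (\<integral>\<^sup>+x. ennreal (\<rho> x) * indicator A x \<partial>lborel)"
      by (simp add: nn_integral_multc K_fst)
    also have "\<dots> = emeasure (density_measure \<rho>) A"
      unfolding density_measure_def by (simp add: emeasure_density)
    finally show "emeasure (distr \<gamma> borel fst) A = \<dots>" .
  qed (simp add: density_measure_def)
  have snd_\<gamma>: "distr \<gamma> borel snd = density_measure \<sigma>"
  proof (rule measure_eqI)
    fix A assume "A \<in> sets (distr \<gamma> borel snd)"
    then have A[measurable]: "A \<in> sets borel" by simp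
    have "emeasure (distr \<gamma> borel snd) A = (\<integral>\<^sup>+z. K z * indicator A (snd z) \<partial>(lborel \<Otimes>\<^sub>M lborel))"
      by (subst nn_integral_indicator[symmetric], simp, subst nn_integral_distr[OF snd], simp)
        (simp add: \<gamma>_def nn_integral_density)
    also have "\<dots> = (\<integral>\<^sup>+y. (\<integral>\<^sup>+x. K (x, y) * indicator A y \<partial>lborel) \<partial>lborel)"
      by (subst lborel_pair.nn_integral_snd[symmetric]) auto
    also have "\<dots> = (\<integral>\<^sup>+y. ennreal (\<sigma> y) * indicator A y \<partial>lborel)"
      by (simp add: nn_integral_multc \<sigma>_K)
    also have "\<dots> = emeasure (density_measure \<sigma>) A"
      unfolding density_measure_def by (simp add: emeasure_density)
    finally show "emeasure (distr \<gamma> borel snd) A = \<dots>" .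
  qed (simp add: density_measure_def)
  have \<gamma>_tot: "emeasure \<gamma> (space \<gamma>) = ennreal t"
  proof -
    have "emeasure \<gamma> (space \<gamma>) = emeasure (distr \<gamma> borel fst) UNIV"
      by (simp add: emeasure_distr)
    then show ?thesis
      unfolding fst_\<gamma> density_measure_def by (simp add: emeasure_density \<rho>_tot)
  qed
  \<comment> \<open>\<open>K\<close> vanishes on pairs at distance \<open>\<delta>\<close> or
    more.\<close>
  have \<gamma>_dist: "AE z in \<gamma>. dist (fst z) (snd z) \<le> \<delta>"
    unfolding \<gamma>_def by (subst AE_density) (auto simp: K_def indicator_def)
  have "(\<integral>\<^sup>+y. ennreal (\<sigma> y) \<partial>lborel) = emeasure (distr \<gamma> borel snd) UNIV"
    unfolding snd_\<gamma> density_measure_def by (simp add: emeasure_density)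
  also have "\<dots> = ennreal t"
    using \<gamma>_tot by (simp add: emeasure_distr)
  finally have "\<sigma> \<in> mass_densities t \<inter> Linf_space lborel"
    using \<sigma>_bounds \<open>t > 0\<close> by (intro bounded_mass_density) auto
  moreover have "Winf t \<rho> \<sigma> \<le> ennreal \<delta>"
    by (rule Winf_le_coupling[OF \<open>t > 0\<close> \<gamma>_tot \<gamma>_borel fst_\<gamma> snd_\<gamma> \<gamma>_dist])
  then have "Winf t \<rho> \<sigma> < ennreal \<epsilon>"
    by (rule le_less_trans) (use \<delta> in \<open>simp add: ennreal_less_iff\<close>)
  moreover have "bounded (measure_support (density_measure \<sigma>))"
    if bdd: "bounded (measure_support (density_measure \<rho>))"
  proof -
    \<comment> \<open>A bound on the first marginal lifts to the coupling, the triangle inequality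
      enlarges it by \<open>\<delta>\<close>, and it descends to the second marginal. The enlarged
      ball is closed and carries the full mass, so it contains the support.\<close>
    obtain R where R: "measure_support (density_measure \<rho>) \<subseteq> cball 0 R"
      using bdd by (auto simp: bounded_iff subset_eq)
    have "AE x in distr \<gamma> borel fst. x \<in> measure_support (density_measure \<rho>)"
      unfolding fst_\<gamma> by (rule AE_measure_support) (simp add: density_measure_def)
    then have "AE x in distr \<gamma> borel fst. x \<in> cball 0 R"
      by eventually_elim (use R in auto)
    then have "AE z in \<gamma>. fst z \<in> cball 0 R"
      by (subst (asm) AE_distr_iff) auto
    with \<gamma>_dist have "AE z in \<gamma>. snd z \<in> cball 0 (R + \<delta>)"
    proof eventually_elim
      case (elim z)
      have "dist 0 (snd z) \<le> dist 0 (fst z) + dist (fst z) (snd z)"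
        by (rule dist_triangle)
      with elim show ?case by (simp del: dist_0_norm)
    qed
    then have "AE y in density_measure \<sigma>. y \<in> cball 0 (R + \<delta>)"
      unfolding snd_\<gamma>[symmetric] by (subst AE_distr_iff) auto
    then have "emeasure (density_measure \<sigma>) (- cball 0 (R + \<delta>)) = 0"
      by (subst (asm) AE_iff_measurable[OF _ refl])
        (auto simp: density_measure_def Collect_neg_eq Compl_eq[symmetric] cball_def)
    then have "measure_support (density_measure \<sigma>) \<subseteq> cball 0 (R + \<delta>)"
      by (intro measure_support_minimal) auto
    then show ?thesis
      using bounded_subset bounded_cball by blast
  qed
  ultimately show "\<exists>\<sigma>. \<sigma> \<in> mass_densities t \<inter> Linf_space lborel \<and>
      Winf t \<rho> \<sigma> < ennreal \<epsilon> \<and>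
      (bounded (measure_support (density_measure \<rho>)) \<longrightarrow>
       bounded (measure_support (density_measure \<sigma>)))"
    by blast
qed

end
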